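(* For every constant $\kappa\in(0,1]$ there are positive constants $c_1,c_2$ (depending only on $\kappa$) such that the following holds. Let $G$ be a $(d,s)$-edge colorable graph of order $n$ with $s\ge 11$ and $s/d=\kappa$, and let $h$ be a standard coloring of $G$. If $\beta\le c_1(2n)^{-c_2 d^{-1}}$, then any $\beta$-sparse list assignment $L$ for $G$ (with respect to $h$) is avoidable.
   Context: Graphs are finite and simple; the order of a graph is its number of vertices. A cycle in an edge-colored graph is $2$-colored if its edges are properly colored by two distinct colors (so a $4$-cycle is $2$-colored if its edges alternate between two distinct colors). For integers $d,s$, a $d$-regular graph $G$ is $(d,s)$-edge colorable if it admits a proper $d$-edge coloring $h$ in which every edge of $G$ is contained in at least $s-1$ $2$-colored $4$-cycles (necessarily $s\le d$). Such a coloring $h$ is called a standard coloring; it is fixed and uses the colors $\{1,\dots,d\}$. A standard matching of $G$ is a maximum set of edges all having the same color under $h$, i.e. a color class of $h$. The distance between two edges $e,e'$ is the number of edges in a shortest path between an endpoint of $e$ and an endpoint of $e'$. The $t$-neighborhood of an edge $e$ is the graph induced by all edges at distance at most $t$ from $e$. A list assignment $L$ for $G$ (assigning to each edge $e$ a possibly empty set $L(e)\subseteq\{1,\dots,d\}$ of forbidden colors) is $\beta$-sparse if (i) $|L(e)|\le \beta s$ for each edge $e$; (ii) for every vertex $v$, each color in $\{1,\dots,d\}$ occurs in at most $\beta s$ lists of edges incident to $v$; (iii) for every $6$-neighborhood $W$ (of any edge) and every standard matching $M$, any color appears at most $\beta s$ times in lists of edges of $M$ contained in $W$. $L$ is avoidable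 if there is a proper $d$-edge coloring $\varphi$ of $G$ with colors $\{1,\dots,d\}$ such that $\varphi(e)\notin L(e)$ for every edge $e$. *)

theory Defs
  imports Complex_Main "HOL-Library.Extended_Nat"
begin

text \<open>A finite simple graph is given by its vertex set and its set of edges; an edge is the
  two-element set of its endpoints.\<close>

definition simple_graph :: "'a set \<Rightarrow> 'a set set \<Rightarrow> bool" where
  "simple_graph V E \<longleftrightarrow> finite V \<and> (\<forall>e\<in>E. e \<subseteq> V \<and> card e = 2)"

definition regular_graph :: "'a set \<Rightarrow> 'a set set \<Rightarrow> nat \<Rightarrow> bool" where
  "regular_graph V E d \<longleftrightarrow> (\<forall>v\<in>V. card {e\<in>E. v \<in> e} = d)"

definition properly_colored :: "'a set set \<Rightarrow> ('a set \<Rightarrow> nat) \<Rightarrow> bool" where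
  "properly_colored F h \<longleftrightarrow>
     (\<forall>e\<in>F. \<forall>f\<in>F. e \<noteq> f \<and> e \<inter> f \<noteq> {} \<longrightarrow> h e \<noteq> h f)"

definition proper_edge_coloring :: "'a set set \<Rightarrow> nat \<Rightarrow> ('a set \<Rightarrow> nat) \<Rightarrow> bool" where
  "proper_edge_coloring E d h \<longleftrightarrow> h ` E \<subseteq> {1..d} \<and> properly_colored E h"

text \<open>Cycles are counted as subgraphs, so a 4-cycle is identified with its set of four edges.\<close>

definition four_cycles :: "'a set set \<Rightarrow> 'a set set set" where
  "four_cycles E =
     {{{a, b}, {b, c}, {c, d}, {d, a}} | a b c d.
        distinct [a, b, c, d] \<and> {{a, b}, {b, c}, {c, d}, {d, a}} \<subseteq> E}"

definition two_colored :: "('a set \<Rightarrow> nat) \<Rightarrow> 'a set set \<Rightarrow> bool" where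
  "two_colored h C \<longleftrightarrow> properly_colored C h \<and> card (h ` C) = 2"

definition standard_coloring :: "'a set set \<Rightarrow> nat \<Rightarrow> nat \<Rightarrow> ('a set \<Rightarrow> nat) \<Rightarrow> bool" where
  "standard_coloring E d s h \<longleftrightarrow>
     proper_edge_coloring E d h \<and>
     (\<forall>e\<in>E. card {C \<in> four_cycles E. e \<in> C \<and> two_colored h C} \<ge> s - 1)"

definition ds_edge_colorable :: "'a set \<Rightarrow> 'a set set \<Rightarrow> nat \<Rightarrow> nat \<Rightarrow> bool" where
  "ds_edge_colorable V E d s \<longleftrightarrow> regular_graph V E d \<and> (\<exists>h. standard_coloring E d s h)"

definition standard_matchings :: "'a set set \<Rightarrow> nat \<Rightarrow> ('a set \<Rightarrow> nat) \<Rightarrow> 'a set set set" where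
  "standard_matchings E d h = {{e\<in>E. h e = c} | c. c \<in> {1..d}}"

definition is_path :: "'a set set \<Rightarrow> 'a list \<Rightarrow> bool" where
  "is_path E p \<longleftrightarrow>
     p \<noteq> [] \<and> distinct p \<and> (\<forall>i. Suc i < length p \<longrightarrow> {p ! i, p ! Suc i} \<in> E)"

text \<open>A path is listed by its vertices, so it has \<open>length p - 1\<close> edges. The distance is
  \<open>\<infinity>\<close>, the infimum of the empty set, when no path joins the two edges.\<close>

definition edge_dist :: "'a set set \<Rightarrow> 'a set \<Rightarrow> 'a set \<Rightarrow> enat" where
  "edge_dist E e f =
     (INF p \<in> {p. is_path E p \<and> hd p \<in> e \<and> last p \<in> f}. enat (length p - 1))"

text \<open>The \<open>t\<close>-neighborhood of \<open>e\<close> is an edge-induced subgraph, hence determined by its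
  edge set.\<close>

definition nbhd :: "'a set set \<Rightarrow> nat \<Rightarrow> 'a set \<Rightarrow> 'a set set" where
  "nbhd E t e = {f\<in>E. edge_dist E e f \<le> enat t}"

definition list_assignment :: "'a set set \<Rightarrow> nat \<Rightarrow> ('a set \<Rightarrow> nat set) \<Rightarrow> bool" where
  "list_assignment E d L \<longleftrightarrow> (\<forall>e\<in>E. L e \<subseteq> {1..d})"

definition sparse ::
  "'a set \<Rightarrow> 'a set set \<Rightarrow> nat \<Rightarrow> nat \<Rightarrow> ('a set \<Rightarrow> nat) \<Rightarrow> real \<Rightarrow> ('a set \<Rightarrow> nat set) \<Rightarrow> bool" where
  "sparse V E d s h \<beta> L \<longleftrightarrow>
     (\<forall>e\<in>E. real (card (L e)) \<le> \<beta> * real s) \<and>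
     (\<forall>v\<in>V. \<forall>c\<in>{1..d}. real (card {e\<in>E. v \<in> e \<and> c \<in> L e}) \<le> \<beta> * real s) \<and>
     (\<forall>e\<in>E. \<forall>M\<in>standard_matchings E d h. \<forall>c\<in>{1..d}.
        real (card {f \<in> M \<inter> nbhd E 6 e. c \<in> L f}) \<le> \<beta> * real s)"

definition avoidable :: "'a set set \<Rightarrow> nat \<Rightarrow> ('a set \<Rightarrow> nat set) \<Rightarrow> bool" where
  "avoidable E d L \<longleftrightarrow> (\<exists>\<phi>. proper_edge_coloring E d \<phi> \<and> (\<forall>e\<in>E. \<phi> e \<notin> L e))"

end

theory Submission
  imports Defs "HOL-Library.FuncSet"
begin

text \<open>Permute the colors of \<open>h\<close> by a random \<open>\<pi>\<close>; call an edge a conflict if its new color is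
  forbidden. For \<open>m = \<beta> s\<close> and \<open>k\<close> about \<open>s / 200\<close>, a fixed vertex meets \<open>k\<close> conflicts with
  probability at most \<open>m ^ k / k!\<close>, and the same bound holds for the event that, for a fixed edge
  \<open>e\<close>, there are \<open>k\<close> two-colored 4-cycles through \<open>e\<close> whose swap creates a conflict on the edge
  opposite to \<open>e\<close>. The bound on \<open>\<beta>\<close> makes a union bound over all vertices and edges work; every
  other local quantity is controlled by sparseness for each \<open>\<pi>\<close>. For each conflict one then has
  many 4-cycles that contain no further conflict and whose swap is harmless, while each such cycle
  meets few candidate cycles of other conflicts. Hence one can choose pairwise edge-disjoint cycles,
  one for each conflict (an independent transversal), and swap the two colors on all of them.\<close>

subsection \<open>Counting\<close>

lemma card_injections:
  assumes "finite S" "finite T" "card S = card T"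
  shows "card {f \<in> S \<rightarrow>\<^sub>E T. inj_on f S} = fact (card S)"
  using card_inj_on_subset_funcset[OF assms(1,2) order.refl] assms(3)
  by (simp add: fact_prod_rev)

text \<open>Elements of \<open>B\<close> are assigned one at a time: the value at \<open>b\<close>
  has at most \<open>m\<close> choices, and what remains is an injection of \<open>S - {b}\<close>
  into \<open>T\<close> without that value. This is why domain and codomain are kept separate even
  though the application has \<open>S = T\<close>. Once \<open>B\<close> is exhausted,
  \<open>card_injections\<close> counts the free part.\<close>

lemma card_restricted_injections:
  assumes "finite S" "finite T" "card S = card T" "B \<subseteq> S"
    and "\<And>b. b \<in> B \<Longrightarrow> finite (A b) \<and> card (A b) \<le> m"
  shows "card {f \<in> S \<rightarrow>\<^sub>E T. inj_on f S \<and> (\<forall>b\<in>B. f b \<in> A b)}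
           \<le> m ^ card B * fact (card S - card B)"
proof -
  have "finite B" using assms(1,4) finite_subset by blast
  then show ?thesis using assms
  proof (induction B arbitrary: S T rule: finite_induct)
    case empty
    then show ?case by (simp add: card_injections)
  next
    case (insert b B)
    let ?F = "\<lambda>S T B. {f \<in> S \<rightarrow>\<^sub>E T. inj_on f S \<and> (\<forall>b\<in>B. f b \<in> A b)}"
    let ?S = "S - {b}"
    have bS: "b \<in> S" using insert.prems by auto
    have fin: "finite (?F ?S (T - {c}) B)" for c
      using insert.prems by (auto intro!: finite_subset[OF _ finite_PiE[of ?S "\<lambda>_. T - {c}"]])
    have IH: "card (?F ?S (T - {c}) B) \<le> m ^ card B * fact (card ?S - card B)" if "c \<in> T" for c
      using insert.prems insert.hyps bS that by (intro insert.IH) auto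
    \<comment> \<open>Each function is encoded by its value at \<open>b\<close> together with its
      restriction to the rest.\<close>
    have "card (?F S T (insert b B)) \<le> card (SIGMA c : A b \<inter> T. ?F ?S (T - {c}) B)"
    proof (rule card_inj_on_le)
      show "inj_on (\<lambda>f. (f b, restrict f ?S)) (?F S T (insert b B))"
      proof (rule inj_onI)
        fix f g assume f: "f \<in> ?F S T (insert b B)" and g: "g \<in> ?F S T (insert b B)"
          and eq: "(f b, restrict f ?S) = (g b, restrict g ?S)"
        show "f = g"
        proof (rule PiE_ext[of f S "\<lambda>_. T"])
          fix x assume "x \<in> S"
          with eq show "f x = g x" by (cases "x = b") (auto dest: fun_cong[of _ _ x])
        qed (use f g in auto)
      qed
      show "(\<lambda>f. (f b, restrict f ?S)) ` ?F S T (insert b B) \<subseteq> (SIGMA c : A b \<inter> T. ?F ?S (T - {c}) B)"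
        using insert.hyps insert.prems bS by (auto simp: inj_on_def PiE_iff)
      show "finite (SIGMA c : A b \<inter> T. ?F ?S (T - {c}) B)"
        using insert.prems fin by auto
    qed
    also have "\<dots> = (\<Sum>c\<in>A b \<inter> T. card (?F ?S (T - {c}) B))"
      using insert.prems fin by (intro card_SigmaI) auto
    also have "\<dots> \<le> (\<Sum>c\<in>A b \<inter> T. m ^ card B * fact (card ?S - card B))"
      using IH by (intro sum_mono) auto
    also have "\<dots> = card (A b \<inter> T) * (m ^ card B * fact (card ?S - card B))" by simp
    also have "\<dots> \<le> m * (m ^ card B * fact (card ?S - card B))"
      using insert.prems(5)[of b] card_mono[of "A b" "A b \<inter> T"] by (intro mult_right_mono) auto
    also have "\<dots> = m ^ card (insert b B) * fact (card S - card (insert b B))"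
      using insert bS by (simp add: card_Diff_singleton)
    finally show ?case .
  qed
qed

text \<open>A union bound over the \<open>k\<close>-subsets \<open>J\<close> of \<open>I\<close>:
  there are at most \<open>card S choose k\<close> of them, and each contributes at most
  \<open>m ^ k * fact (card S - k)\<close>. Divided by \<open>fact (card S)\<close>, this is the
  probability bound \<open>m ^ k / k!\<close>. The map \<open>key\<close> allows the random objects
  to be indexed by edges or by cycles, provided that different indices read the permutation at
  different colors.\<close>

lemma card_injections_many_hits:
  assumes "finite S" "finite I" "inj_on key I" "key ` I \<subseteq> S"
    and A: "\<And>i. i \<in> I \<Longrightarrow> finite (A i) \<and> card (A i) \<le> m"
  shows "card {f \<in> S \<rightarrow>\<^sub>E S. inj_on f S \<and> k \<le> card {i \<in> I. f (key i) \<in> A i}} * fact k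
           \<le> m ^ k * fact (card S)"
proof -
  let ?F = "{f \<in> S \<rightarrow>\<^sub>E S. inj_on f S \<and> k \<le> card {i \<in> I. f (key i) \<in> A i}}"
  let ?G = "\<lambda>J. {f \<in> S \<rightarrow>\<^sub>E S. inj_on f S \<and> (\<forall>b\<in>key ` J. f b \<in> A (inv_into I key b))}"
  let ?J = "{J. J \<subseteq> I \<and> card J = k}"
  have cI: "card I \<le> card S" using assms by (meson card_inj_on_le)
  have finJ: "finite ?J" using assms by auto
  have finG: "finite (?G J)" for J
    using assms by (auto intro!: finite_subset[OF _ finite_PiE[of S "\<lambda>_. S"]])
  have sub: "?F \<subseteq> (\<Union>J\<in>?J. ?G J)"
  proof
    fix f assume f: "f \<in> ?F"
    then obtain J where J: "J \<subseteq> {i \<in> I. f (key i) \<in> A i}" "card J = k"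
      using obtain_subset_with_card_n[of k "{i \<in> I. f (key i) \<in> A i}"] by auto
    have "f \<in> ?G J" using f J assms(3) by (auto simp: inv_into_f_f subset_iff)
    then show "f \<in> (\<Union>J\<in>?J. ?G J)" using J by auto
  qed
  have G: "card (?G J) \<le> m ^ k * fact (card S - k)" if "J \<in> ?J" for J
  proof -
    have "card (key ` J) = k" using that assms(3) by (auto simp: card_image inj_on_subset)
    moreover have "card (?G J) \<le> m ^ card (key ` J) * fact (card S - card (key ` J))"
      using that assms by (intro card_restricted_injections) (auto simp: inv_into_f_f subset_iff)
    ultimately show ?thesis by simp
  qed
  have "card ?F \<le> card (\<Union>J\<in>?J. ?G J)" using sub finJ finG by (intro card_mono) auto
  also have "\<dots> \<le> (\<Sum>J\<in>?J. card (?G J))" using finJ by (rule card_UN_le)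
  also have "\<dots> \<le> (\<Sum>J\<in>?J. m ^ k * fact (card S - k))" using G by (intro sum_mono)
  also have "\<dots> = (card I choose k) * (m ^ k * fact (card S - k))"
    using assms by (simp add: n_subsets)
  finally have F: "card ?F \<le> (card I choose k) * (m ^ k * fact (card S - k))" .
  show ?thesis
  proof (cases "k \<le> card S")
    case True
    have "card ?F * fact k \<le> (card S choose k) * (m ^ k * fact (card S - k)) * fact k"
      using F cI by (intro mult_right_mono order.trans[OF F] mult_mono binomial_right_mono) auto
    also have "\<dots> = m ^ k * (fact k * fact (card S - k) * (card S choose k))"
      by (simp add: ac_simps)
    also have "\<dots> = m ^ k * fact (card S)"
      using True by (simp only: binomial_fact_lemma)
    finally show ?thesis .
  next
    \<comment> \<open>Here \<open>card I \<le> card S < k\<close>, so no \<open>k\<close>-subset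
      exists and the count is zero.\<close>
    case False
    then have "card I choose k = 0" using cI by (intro binomial_eq_0) auto
    then have "card ?F = 0" using F by (simp only: mult_0)
    then show ?thesis by (simp only: mult_0)
  qed
qed

text \<open>Rosenfeld's counting argument: adding a part multiplies the number of independent
  transversals by at least \<open>K / 2\<close>, so few of the extensions are spoiled by any fixed
  neighbour.\<close>

lemma independent_transversal:
  fixes part :: "'i \<Rightarrow> 'b set" and K \<Delta> :: nat
  assumes "finite I" and sym: "\<And>x y. R x y \<Longrightarrow> R y x"
    and part: "\<And>i. i \<in> I \<Longrightarrow> finite (part i) \<and> K \<le> card (part i)"
    and K: "0 < K" "4 * \<Delta> \<le> K"
    and deg: "\<And>i x. i \<in> I \<Longrightarrow> x \<in> part i \<Longrightarrow>
      card {(j, y). j \<in> I \<and> j \<noteq> i \<and> y \<in> part j \<and> R x y} \<le> \<Delta>"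
  obtains t where "\<And>i. i \<in> I \<Longrightarrow> t i \<in> part i"
    and "\<And>i j. i \<in> I \<Longrightarrow> j \<in> I \<Longrightarrow> i \<noteq> j \<Longrightarrow> \<not> R (t i) (t j)"
proof -
  define T where "T S = {t \<in> PiE S part. \<forall>i\<in>S. \<forall>j\<in>S. i \<noteq> j \<longrightarrow> \<not> R (t i) (t j)}" for S
  have finS: "finite S" if "S \<subseteq> I" for S using that assms(1) finite_subset by blast
  have finT: "finite (T S)" if "S \<subseteq> I" for S
    unfolding T_def using that finS[OF that] part
    by (auto intro!: finite_subset[OF _ finite_PiE[of S part]])
  have step: "K * card (T S) \<le> 2 * card (T (insert e S))" if "S \<subseteq> I" "e \<in> I - S" for S e
    using that
  \<comment> \<open>Strong induction, with \<open>e\<close> arbitrary, because the claim is reused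
    for the smaller set \<open>S - {j}\<close> with \<open>j\<close> as the new index.\<close>
  proof (induction "card S" arbitrary: S e rule: less_induct)
    case less
    let ?p = "card (part e)"
    define N where "N x = {(j, y). j \<in> I \<and> j \<noteq> e \<and> y \<in> part j \<and> R x y}" for x
    \<comment> \<open>Pairs of a choice \<open>x\<close> at \<open>e\<close> and a transversal
      \<open>t\<close> of \<open>S\<close> that already uses a neighbour of \<open>x\<close>. Every
      other pair gives a transversal of \<open>insert e S\<close>.\<close>
    define Bad where "Bad = (SIGMA x : part e. \<Union>(j, y)\<in>N x \<inter> (S \<times> UNIV). {t \<in> T S. t j = y})"
    have eI: "e \<in> I" using less by auto
    have finN: "finite (N x)" for x
      by (rule finite_subset[of _ "Sigma I part"]) (use part assms(1) N_def in auto)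
    \<comment> \<open>With the value at \<open>j\<close> fixed, forgetting \<open>j\<close> is
      injective into \<open>T (S - {j})\<close>; by the induction hypothesis that set has at most
      \<open>2 / K\<close> times as many elements as \<open>T S\<close>.\<close>
    have few: "K * card {t \<in> T S. t j = y} \<le> 2 * card (T S)" if "j \<in> S" for j y
    proof -
      have "card {t \<in> T S. t j = y} \<le> card (T (S - {j}))"
      proof (rule card_inj_on_le)
        show "inj_on (\<lambda>t. restrict t (S - {j})) {t \<in> T S. t j = y}"
        proof (rule inj_onI)
          fix f g assume f: "f \<in> {t \<in> T S. t j = y}" and g: "g \<in> {t \<in> T S. t j = y}"
            and eq: "restrict f (S - {j}) = restrict g (S - {j})"
          show "f = g"
          proof (rule PiE_ext[of f S part])
            fix x assume "x \<in> S"
            with eq f g show "f x = g x" by (cases "x = j") (auto dest: fun_cong[of _ _ x])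
          qed (use f g T_def in auto)
        qed
        show "(\<lambda>t. restrict t (S - {j})) ` {t \<in> T S. t j = y} \<subseteq> T (S - {j})"
          by (auto simp: T_def PiE_iff split: if_splits)
        show "finite (T (S - {j}))" using less by (intro finT) auto
      qed
      then have "K * card {t \<in> T S. t j = y} \<le> K * card (T (S - {j}))" by (rule mult_le_mono2)
      also have "K * card (T (S - {j})) \<le> 2 * card (T (insert j (S - {j})))"
        using less that finS[of S] by (intro less.hyps) (auto intro!: psubset_card_mono simp del: card_Diff_insert card_Diff_singleton)
      also have "insert j (S - {j}) = S" using that by auto
      finally show ?thesis .
    qed
    have badx: "K * card (\<Union>(j, y)\<in>N x \<inter> (S \<times> UNIV). {t \<in> T S. t j = y}) \<le> \<Delta> * (2 * card (T S))"
      if "x \<in> part e" for x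
    proof -
      have "K * card (\<Union>(j, y)\<in>N x \<inter> (S \<times> UNIV). {t \<in> T S. t j = y})
        \<le> K * (\<Sum>(j, y)\<in>N x \<inter> (S \<times> UNIV). card {t \<in> T S. t j = y})"
        using card_UN_le[of "N x \<inter> (S \<times> UNIV)" "\<lambda>(j, y). {t \<in> T S. t j = y}"] finN
        by (intro mult_left_mono) (auto simp: case_prod_beta)
      also have "\<dots> = (\<Sum>(j, y)\<in>N x \<inter> (S \<times> UNIV). K * card {t \<in> T S. t j = y})"
        by (simp add: sum_distrib_left case_prod_beta)
      also have "\<dots> \<le> (\<Sum>(j, y)\<in>N x \<inter> (S \<times> UNIV). 2 * card (T S))"
        using few by (intro sum_mono) auto
      also have "\<dots> = card (N x \<inter> (S \<times> UNIV)) * (2 * card (T S))" by simp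
      also have "\<dots> \<le> \<Delta> * (2 * card (T S))"
        using deg[OF eI that] card_mono[OF finN[of x], of "N x \<inter> (S \<times> UNIV)"]
        unfolding N_def by (intro mult_right_mono) auto
      finally show ?thesis .
    qed
    have finB: "finite (\<Union>(j, y)\<in>N x \<inter> (S \<times> UNIV). {t \<in> T S. t j = y})" for x
      using finN finT less.prems by auto
    have "K * card Bad = (\<Sum>x\<in>part e. K * card (\<Union>(j, y)\<in>N x \<inter> (S \<times> UNIV). {t \<in> T S. t j = y}))"
      unfolding Bad_def using part[OF eI] finB by (subst card_SigmaI) (auto simp: sum_distrib_left)
    also have "\<dots> \<le> (\<Sum>x\<in>part e. \<Delta> * (2 * card (T S)))"
      using badx by (intro sum_mono)
    also have "\<dots> = ?p * card (T S) * (2 * \<Delta>)" by simp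
    finally have "2 * (K * card Bad) \<le> 2 * (?p * card (T S) * (2 * \<Delta>))" by (rule mult_le_mono2)
    also have "\<dots> = ?p * card (T S) * (4 * \<Delta>)" by simp
    \<comment> \<open>The hypothesis \<open>4 * \<Delta> \<le> K\<close> enters here: at most half
      of all pairs are bad, so at least half of them extend.\<close>
    also have "\<dots> \<le> ?p * card (T S) * K" using K by (intro mult_left_mono) auto
    finally have "K * (2 * card Bad) \<le> K * (?p * card (T S))" by (simp add: mult_ac)
    then have bad: "2 * card Bad \<le> ?p * card (T S)" using K by simp
    have fin: "finite (part e \<times> T S)" using part[OF eI] finT less.prems by auto
    have "card (part e \<times> T S - Bad) \<le> card (T (insert e S))"
    proof (rule card_inj_on_le)
      show "inj_on (\<lambda>(x, t). t(e := x)) (part e \<times> T S - Bad)"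
      proof (rule inj_onI, clarify)
        fix x f y g assume *: "(f::'i \<Rightarrow> 'b)(e := x) = g(e := y)" "f \<in> T S" "g \<in> T S"
        have "f = g"
        proof (rule PiE_ext[of f S part])
          fix i assume "i \<in> S"
          with *(1) less.prems show "f i = g i" by (metis DiffD2 fun_upd_other)
        qed (use * T_def in auto)
        then show "x = y \<and> f = g" using *(1) by (metis fun_upd_same)
      qed
      show "(\<lambda>(x, t). t(e := x)) ` (part e \<times> T S - Bad) \<subseteq> T (insert e S)"
      proof clarify
        fix x t assume x: "x \<in> part e" "t \<in> T S" "(x, t) \<notin> Bad"
        have "\<not> R x (t j)" if "j \<in> S" for j
        proof
          assume "R x (t j)"
          moreover have "t j \<in> part j" using x(2) that by (auto simp: T_def)
          ultimately have "(j, t j) \<in> N x \<inter> (S \<times> UNIV)" using that less.prems by (auto simp: N_def)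
          then show False using x unfolding Bad_def by blast
        qed
        moreover from this have "\<not> R (t j) x" if "j \<in> S" for j using sym that by blast
        ultimately show "t(e := x) \<in> T (insert e S)"
          using x less.prems unfolding T_def by (auto simp: PiE_iff extensional_def)
      qed
      show "finite (T (insert e S))" using less.prems by (intro finT) auto
    qed
    moreover have "card (part e \<times> T S - Bad) \<ge> ?p * card (T S) - card Bad"
      using diff_card_le_card_Diff[of Bad "part e \<times> T S"] fin finB
      unfolding Bad_def using part[OF eI] by (auto simp: card_cartesian_product)
    ultimately have "2 * card (T (insert e S)) \<ge> ?p * card (T S)" using bad by linarith
    moreover have "?p * card (T S) \<ge> K * card (T S)" using part[OF eI] by simp
    ultimately show ?case by linarith
  qed
  have "T S \<noteq> {}" if "S \<subseteq> I" for S
    using finS[OF that] that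
  proof (induction S rule: finite_induct)
    case empty then show ?case by (simp add: T_def)
  next
    case (insert e S)
    then have "card (T S) > 0" using finT[of S] by (simp add: card_gt_0_iff)
    then have "0 < K * card (T S)" using K by simp
    also have "\<dots> \<le> 2 * card (T (insert e S))" using insert by (intro step) auto
    finally show ?case by auto
  qed
  then obtain t where "t \<in> T I" by blast
  then show thesis using that[of t] by (auto simp: T_def PiE_iff)
qed

text \<open>A weak Stirling bound: the term \<open>k ^ k / k!\<close> is at most the whole series of
  \<open>exp k\<close>, and \<open>exp 1 \<le> 3\<close>.\<close>

lemma power_self_le_fact: "real k ^ k \<le> 3 ^ k * fact k"
proof -
  have "(\<Sum>n\<in>{k}. inverse (fact n) * real k ^ n) \<le> (\<Sum>n. inverse (fact n) * real k ^ n)"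
    by (rule sum_le_suminf) (auto simp: summable_exp)
  then have "real k ^ k \<le> exp (real k) * fact k"
    by (simp add: exp_def field_simps)
  also have "exp (real k) = exp 1 ^ k" by (simp flip: exp_of_nat_mult)
  also have "exp 1 ^ k * fact k \<le> (3 :: real) ^ k * fact k"
    using exp_le by (intro mult_right_mono power_mono) auto
  finally show ?thesis .
qed

subsection \<open>Swapping two-colored 4-cycles\<close>

text \<open>A normal form in which a chosen edge and a chosen endpoint of it come first. Adjacent
  edges differ in color and only two colors occur, so opposite edges agree; the symmetries of the
  square do the relabelling.\<close>

lemma two_colored_four_cycleE:
  assumes "C \<in> four_cycles E" "two_colored h C" "f \<in> C" "u \<in> f"
  obtains v w x where "f = {u, v}" "C = {{u, v}, {u, w}, {v, x}, {w, x}}" "distinct [u, v, w, x]"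
    "h {w, x} = h {u, v}" "h {v, x} = h {u, w}" "h {u, v} \<noteq> h {u, w}" "C \<subseteq> E"
proof -
  obtain a b c d where C: "C = {{a, b}, {b, c}, {c, d}, {d, a}}" and dist: "distinct [a, b, c, d]"
    and CE: "C \<subseteq> E"
    using assms(1) unfolding four_cycles_def by auto
  have col: "h e \<noteq> h g" if "e \<in> C" "g \<in> C" "e \<noteq> g" "e \<inter> g \<noteq> {}" for e g
    using assms(2) that unfolding two_colored_def properly_colored_def by blast
  \<comment> \<open>\<open>Q\<close> records one cyclic labelling. Below, \<open>rot\<close> moves
    \<open>f\<close> to the front and \<open>refl\<close> exchanges its endpoints if needed.\<close>
  define Q where "Q a b c d \<longleftrightarrow> C = {{a, b}, {b, c}, {c, d}, {d, a}} \<and> distinct [a, b, c, d] \<and>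
    h {c, d} = h {a, b} \<and> h {d, a} = h {b, c} \<and> h {a, b} \<noteq> h {b, c}" for a b c d
  have n: "h {a, b} \<noteq> h {b, c}" "h {b, c} \<noteq> h {c, d}" "h {c, d} \<noteq> h {d, a}" "h {d, a} \<noteq> h {a, b}"
    using dist dist[THEN distinct_rev[THEN iffD2]] col[of "{a, b}" "{b, c}"] col[of "{b, c}" "{c, d}"]
      col[of "{c, d}" "{d, a}"] col[of "{d, a}" "{a, b}"]
    by (simp_all add: C doubleton_eq_iff)
  have "card {h {a, b}, h {b, c}, h {c, d}, h {d, a}} = 2"
    using assms(2) unfolding two_colored_def C by simp
  then have "h {c, d} = h {a, b}" "h {d, a} = h {b, c}"
    using n unfolding card_2_iff by (metis insert_iff singletonD)+
  then have Q: "Q a b c d" unfolding Q_def using C dist n by blast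
  have rot: "Q y z x w" if "Q w y z x" for w x y z
  proof -
    have "{{w, y}, {y, z}, {z, x}, {x, w}} = {{y, z}, {z, x}, {x, w}, {w, y}}" by blast
    then show ?thesis using that unfolding Q_def by auto
  qed
  have refl: "Q y w x z" if "Q w y z x" for w x y z
  proof -
    have "{{w, y}, {y, z}, {z, x}, {x, w}} = {{y, w}, {w, x}, {x, z}, {z, y}}"
      by (simp add: insert_commute)
    then show ?thesis using that unfolding Q_def by (auto simp: insert_commute)
  qed
  have "\<exists>v x w. f = {u, v} \<and> Q u v x w"
  proof -
    have "f = {a, b} \<or> f = {b, c} \<or> f = {c, d} \<or> f = {d, a}" using assms(3) C by blast
    then obtain y z p q where *: "Q y z p q" "f = {y, z}" using Q rot by metis
    then show ?thesis using refl[OF *(1)] assms(4) by (metis insert_iff singletonD insert_commute)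
  qed
  then obtain v x w where vxw: "f = {u, v}" "Q u v x w" by blast
  show thesis
  proof (rule that[of v w x])
    show "C = {{u, v}, {u, w}, {v, x}, {w, x}}"
      using vxw(2) unfolding Q_def by (simp add: insert_commute)
    show "distinct [u, v, w, x]" using vxw(2) unfolding Q_def by auto
    have "{w, u} = {u, w}" "{x, w} = {w, x}" by auto
    then show "h {w, x} = h {u, v}" "h {v, x} = h {u, w}" "h {u, v} \<noteq> h {u, w}"
      using vxw(2) unfolding Q_def by simp_all
  qed (use vxw CE in auto)
qed

section \<open>Two-colored 4-cycles through a fixed edge\<close>

definition cycles_through :: "'a set set \<Rightarrow> ('a set \<Rightarrow> nat) \<Rightarrow> 'a set \<Rightarrow> 'a set set set" where
  "cycles_through E h e = {C \<in> four_cycles E. e \<in> C \<and> two_colored h C}"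

text \<open>The description is unambiguous when \<open>C\<close> is a two-colored 4-cycle containing
  \<open>f\<close>, since then exactly one color of \<open>C\<close> differs from
  \<open>h f\<close>. Elsewhere the value is irrelevant.\<close>

definition swapped :: "('a set \<Rightarrow> nat) \<Rightarrow> 'a set set \<Rightarrow> 'a set \<Rightarrow> nat" where
  "swapped h C f = (THE c. c \<in> h ` C \<and> c \<noteq> h f)"

locale edge_colored_graph =
  fixes E :: "'a set set" and h :: "'a set \<Rightarrow> nat"
  assumes fin_E: "finite E" and card_edge: "e \<in> E \<Longrightarrow> card e = 2" and proper: "properly_colored E h"
begin

abbreviation "cyc \<equiv> cycles_through E h"

lemma same_color_at_vertex:
  assumes "e \<in> E" "f \<in> E" "v \<in> e" "v \<in> f" "h e = h f"
  shows "e = f"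
  using proper assms unfolding properly_colored_def by blast

lemma inj_on_at_vertex: "inj_on h {f \<in> E. v \<in> f}"
  by (rule inj_onI) (use same_color_at_vertex in blast)

lemma cyc_cong: "C \<in> cyc e \<Longrightarrow> f \<in> C \<Longrightarrow> C \<in> cyc f"
  by (simp add: cycles_through_def)

lemma cyc_mem: "C \<in> cyc e \<Longrightarrow> e \<in> C"
  by (simp add: cycles_through_def)

lemma cyc_subset: "C \<in> cyc e \<Longrightarrow> C \<subseteq> E"
  unfolding cycles_through_def four_cycles_def by auto

lemma cycE:
  assumes "C \<in> cyc f" "u \<in> f"
  obtains v w x where "f = {u, v}" "C = {{u, v}, {u, w}, {v, x}, {w, x}}" "distinct [u, v, w, x]"
    "h {w, x} = h {u, v}" "h {v, x} = h {u, w}" "h {u, v} \<noteq> h {u, w}" "C \<subseteq> E"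
  by (rule two_colored_four_cycleE[of C E h f u]) (use assms in \<open>auto simp: cycles_through_def\<close>)

lemma finite_cyc: "finite (cyc e)"
  by (rule finite_subset[of _ "Pow E"]) (use cyc_subset in blast, simp add: fin_E)

lemma cyc_nonempty_edge: "C \<in> cyc e \<Longrightarrow> e \<in> E \<and> (\<exists>u. u \<in> e)"
  using cyc_mem[of C e] cyc_subset[of C e] card_edge[of e] by (cases "e = {}") auto

text \<open>Once the second color is known, the two edges of \<open>C\<close> leaving the endpoints
  of \<open>e\<close> are the unique edges of that color there, and they fix the remaining
  vertices.\<close>

lemma cyc_determined:
  assumes C: "C \<in> cyc e" and D: "D \<in> cyc e" and eq: "h ` C = h ` D"
  shows "C = D"
proof -
  obtain u where "u \<in> e" using cyc_nonempty_edge[OF C] by blast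
  obtain v w x where 1: "e = {u, v}" "C = {{u, v}, {u, w}, {v, x}, {w, x}}" "distinct [u, v, w, x]"
    "h {w, x} = h {u, v}" "h {v, x} = h {u, w}" "h {u, v} \<noteq> h {u, w}" "C \<subseteq> E"
    using cycE[OF C \<open>u \<in> e\<close>] .
  obtain v' w' x' where 2: "e = {u, v'}" "D = {{u, v'}, {u, w'}, {v', x'}, {w', x'}}"
    "distinct [u, v', w', x']"
    "h {w', x'} = h {u, v'}" "h {v', x'} = h {u, w'}" "h {u, v'} \<noteq> h {u, w'}" "D \<subseteq> E"
    using cycE[OF D \<open>u \<in> e\<close>] .
  have v: "v' = v" using 1(1) 2(1) by (auto simp: doubleton_eq_iff)
  have "h ` C = {h {u, v}, h {u, w}}" unfolding 1(2) using 1(4,5) by auto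
  moreover have "h ` D = {h {u, v}, h {u, w'}}" unfolding 2(2) v using 2(4,5) v by auto
  ultimately have hw: "h {u, w} = h {u, w'}" using eq by (metis doubleton_eq_iff)
  have "{u, w} = {u, w'}" by (rule same_color_at_vertex[of _ _ u]) (use hw 1(2,7) 2(2,7) in auto)
  moreover have "{v, x} = {v, x'}"
    by (rule same_color_at_vertex[of _ _ v]) (use hw 1(2,5,7) 2(2,5,7) v in auto)
  ultimately have "w' = w" "x' = x" by (auto simp: doubleton_eq_iff)
  then show ?thesis using 1(2) 2(2) v by simp
qed

lemma swapped:
  assumes "C \<in> cyc f"
  shows "swapped h C f \<noteq> h f" "h ` C = {h f, swapped h C f}"
proof -
  obtain u where "u \<in> f" using cyc_nonempty_edge[OF assms] by blast
  obtain v w x where 1: "f = {u, v}" "C = {{u, v}, {u, w}, {v, x}, {w, x}}" "distinct [u, v, w, x]"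
    "h {w, x} = h {u, v}" "h {v, x} = h {u, w}" "h {u, v} \<noteq> h {u, w}" "C \<subseteq> E"
    using cycE[OF assms \<open>u \<in> f\<close>] .
  have hC: "h ` C = {h f, h {u, w}}" unfolding 1(1,2) using 1(4,5) by auto
  have "swapped h C f = h {u, w}"
    unfolding swapped_def hC using 1(1,6) by (intro the_equality) auto
  then show "swapped h C f \<noteq> h f" "h ` C = {h f, swapped h C f}" using hC 1(1,6) by auto
qed

lemma swapped_eqI: "C \<in> cyc e \<Longrightarrow> f \<in> C \<Longrightarrow> h f \<noteq> h e \<Longrightarrow> swapped h C e = h f"
  using swapped(2)[of C e] by (metis image_eqI insert_iff singletonD)

lemma swapped_same: "C \<in> cyc e \<Longrightarrow> f \<in> C \<Longrightarrow> h f = h e \<Longrightarrow> swapped h C f = swapped h C e"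
  unfolding swapped_def by simp

text \<open>Cycles through \<open>e\<close> may thus be counted by their second color. This makes
  the swapped color a valid \<open>key\<close> for \<open>card_injections_many_hits\<close>.\<close>

lemma inj_on_swapped: "inj_on (\<lambda>C. swapped h C e) (cyc e)"
  by (rule inj_onI) (metis cyc_determined swapped(2))

lemma cyc_determined_edges:
  assumes C: "C \<in> cyc e" and D: "D \<in> cyc e" and "f \<in> C" "f \<in> D" "h f \<noteq> h e"
  shows "C = D"
  using assms swapped_eqI inj_on_swapped by (metis inj_onD)

text \<open>The new color of an edge is the old color of its neighbour on the cycle, so a swap only
  exchanges two colors at each vertex of the cycle. Properness after swapping rests on this.\<close>

lemma swapped_at_vertex:
  assumes "C \<in> cyc f" "u \<in> f"
  obtains f' where "f' \<in> C" "u \<in> f'" "h f' = swapped h C f"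
proof -
  obtain v w x where 1: "f = {u, v}" "C = {{u, v}, {u, w}, {v, x}, {w, x}}" "distinct [u, v, w, x]"
    "h {w, x} = h {u, v}" "h {v, x} = h {u, w}" "h {u, v} \<noteq> h {u, w}" "C \<subseteq> E"
    using cycE[OF assms] .
  show thesis by (rule that[of "{u, w}"]) (use 1(1,2,6) swapped_eqI[OF assms(1), of "{u, w}"] in auto)
qed

section \<open>Simultaneous swaps on disjoint cycles\<close>

definition swap_all :: "'a set set set \<Rightarrow> 'a set \<Rightarrow> nat" where
  "swap_all \<C> f = (if f \<in> \<Union>\<C> then swapped h (THE C. C \<in> \<C> \<and> f \<in> C) f else h f)"

lemma swap_all_in:
  assumes "pairwise disjnt \<C>" "C \<in> \<C>" "f \<in> C"
  shows "swap_all \<C> f = swapped h C f"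
proof -
  have "(THE C. C \<in> \<C> \<and> f \<in> C) = C"
    using assms by (intro the_equality) (auto simp: pairwise_def disjnt_iff)
  then show ?thesis using assms unfolding swap_all_def by auto
qed

text \<open>Every edge at \<open>v\<close> has a partner at \<open>v\<close> whose old color is its
  new one: itself if it is not swapped, otherwise its neighbour on its cycle. Two edges at
  \<open>v\<close> with equal new colors have the same partner; disjointness puts them on the same
  cycle or leaves both unswapped, and in either case they coincide.\<close>

lemma properly_colored_swap_all:
  assumes disj: "pairwise disjnt \<C>" and cyc: "\<And>C f. C \<in> \<C> \<Longrightarrow> f \<in> C \<Longrightarrow> C \<in> cyc f"
  shows "properly_colored E (swap_all \<C>)"
proof -
  have partner: "\<exists>f'\<in>E. v \<in> f' \<and> h f' = swap_all \<C> f \<and> (f' = f \<and> f \<notin> \<Union>\<C> \<or> (\<exists>C\<in>\<C>. f \<in> C \<and> f' \<in> C))"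
    if "f \<in> E" "v \<in> f" for f v
  proof (cases "f \<in> \<Union>\<C>")
    case True
    then obtain C where C: "C \<in> \<C>" "f \<in> C" by blast
    obtain f' where "f' \<in> C" "v \<in> f'" "h f' = swapped h C f"
      using swapped_at_vertex[OF cyc[OF C] \<open>v \<in> f\<close>] .
    then show ?thesis using C swap_all_in[OF disj C] cyc_subset[OF cyc[OF C]] by auto
  next
    case False
    then show ?thesis using that unfolding swap_all_def by auto
  qed
  show ?thesis unfolding properly_colored_def
  proof (intro ballI impI notI)
    fix f g assume f: "f \<in> E" and g: "g \<in> E" and fg: "f \<noteq> g \<and> f \<inter> g \<noteq> {}"
      and eq: "swap_all \<C> f = swap_all \<C> g"
    from fg obtain v where v: "v \<in> f" "v \<in> g" by blast
    obtain f' where f': "f' \<in> E" "v \<in> f'" "h f' = swap_all \<C> f"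
      "f' = f \<and> f \<notin> \<Union>\<C> \<or> (\<exists>C\<in>\<C>. f \<in> C \<and> f' \<in> C)" using partner[OF f v(1)] by blast
    obtain g' where g': "g' \<in> E" "v \<in> g'" "h g' = swap_all \<C> g"
      "g' = g \<and> g \<notin> \<Union>\<C> \<or> (\<exists>C\<in>\<C>. g \<in> C \<and> g' \<in> C)" using partner[OF g v(2)] by blast
    have "f' = g'" using f' g' eq same_color_at_vertex by metis
    then consider "f = g" | C D where "C \<in> \<C>" "f \<in> C" "f' \<in> C" "D \<in> \<C>" "g \<in> D" "f' \<in> D"
      using f'(4) g'(4) by blast
    then have "f = g"
    proof cases
      case 2
      then have "C = D" using disj by (auto simp: pairwise_def disjnt_iff)
      then have "swapped h C f = swapped h C g" using 2 eq swap_all_in[OF disj] by metis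
      moreover have "C \<in> cyc f" "C \<in> cyc g" using 2 cyc \<open>C = D\<close> by auto
      ultimately have "h f = h g" using swapped[of C f] swapped[of C g] by (metis doubleton_eq_iff)
      then show ?thesis using f g v same_color_at_vertex by blast
    qed
    then show False using fg by blast
  qed
qed

section \<open>Counting the cycles through an edge that meet a given set of edges\<close>

lemma opposite_edge:
  assumes "C \<in> cyc e" "f \<in> C" "f \<noteq> e" "h f = h e" "u \<in> e"
  obtains x where "x \<in> f" "{u, x} \<in> C" "h {u, x} \<noteq> h e" "u \<noteq> x"
proof -
  obtain v w x where 1: "e = {u, v}" "C = {{u, v}, {u, w}, {v, x}, {w, x}}" "distinct [u, v, w, x]"
    "h {w, x} = h {u, v}" "h {v, x} = h {u, w}" "h {u, v} \<noteq> h {u, w}" "C \<subseteq> E"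
    using cycE[OF assms(1,5)] .
  show thesis by (rule that[of w]) (use 1(1-6) assms(2-4) in auto)
qed

lemma adjacent_edge:
  assumes "C \<in> cyc e" "f \<in> C" "h f \<noteq> h e"
  shows "e \<inter> f \<noteq> {}"
proof -
  obtain u where "u \<in> e" using cyc_nonempty_edge[OF assms(1)] by blast
  obtain v w x where 1: "e = {u, v}" "C = {{u, v}, {u, w}, {v, x}, {w, x}}" "distinct [u, v, w, x]"
    "h {w, x} = h {u, v}" "h {v, x} = h {u, w}" "h {u, v} \<noteq> h {u, w}" "C \<subseteq> E"
    using cycE[OF assms(1) \<open>u \<in> e\<close>] .
  then show ?thesis using assms(2,3) by auto
qed

lemma opposite_edge_unique:
  assumes "C \<in> cyc e" "f \<in> C" "f \<noteq> e" "h f = h e" "g \<in> C" "g \<noteq> e" "h g = h e"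
  shows "f = g"
proof -
  obtain u where "u \<in> e" using cyc_nonempty_edge[OF assms(1)] by blast
  obtain v w x where 1: "e = {u, v}" "C = {{u, v}, {u, w}, {v, x}, {w, x}}" "distinct [u, v, w, x]"
    "h {w, x} = h {u, v}" "h {v, x} = h {u, w}" "h {u, v} \<noteq> h {u, w}" "C \<subseteq> E"
    using cycE[OF assms(1) \<open>u \<in> e\<close>] .
  then show ?thesis using assms(2-7) by auto
qed

lemma card_cycle:
  assumes "C \<in> cyc e"
  shows "finite C" "card C \<le> 4"
proof -
  obtain u where "u \<in> e" using cyc_nonempty_edge[OF assms] by blast
  then obtain v w x where C: "C = set [{u, v}, {u, w}, {v, x}, {w, x}]"
    using cycE[OF assms, of u] by (metis list.simps(15) list.set(1))
  show "finite C" unfolding C by simp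
  show "card C \<le> 4" unfolding C using card_length[of "[{u, v}, {u, w}, {v, x}, {w, x}]"] by simp
qed

text \<open>One edge of the cycle joins \<open>e\<close> to \<open>f\<close>, so their distance is
  at most 1. Condition (iii) of sparseness therefore applies to opposite edges.\<close>

lemma opposite_edge_in_nbhd:
  assumes "C \<in> cyc e" "f \<in> C" "f \<noteq> e" "h f = h e"
  shows "f \<in> nbhd E 6 e"
proof -
  obtain u where u: "u \<in> e" using cyc_nonempty_edge[OF assms(1)] by blast
  obtain x where x: "x \<in> f" "{u, x} \<in> C" "u \<noteq> x" using opposite_edge[OF assms u] by blast
  have E: "f \<in> E" "{u, x} \<in> E" using x assms cyc_subset by blast+
  have "edge_dist E e f \<le> enat (length [u, x] - 1)"
    unfolding edge_dist_def by (rule INF_lower) (use u x E in \<open>auto simp: is_path_def\<close>)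
  also have "\<dots> \<le> enat 6" by simp
  finally show ?thesis using E by (simp add: nbhd_def)
qed

text \<open>A cycle edge of the other color meets \<open>e\<close> and determines the cycle, so
  choosing one such edge in \<open>P\<close> is injective; each of the two endpoints of
  \<open>e\<close> offers at most \<open>k\<close> choices.\<close>

lemma card_adjacent_cycles:
  assumes "e \<in> E" and P: "\<And>v. v \<in> e \<Longrightarrow> card {f \<in> E. v \<in> f \<and> f \<in> P} \<le> k"
  shows "card {C \<in> cyc e. \<exists>f\<in>C. h f \<noteq> h e \<and> f \<in> P} \<le> 2 * k"
proof -
  let ?G = "(\<Union>v\<in>e. {f \<in> E. v \<in> f \<and> f \<in> P})"
  define g where "g C = (SOME f. f \<in> C \<and> h f \<noteq> h e \<and> f \<in> P)" for C
  have g: "g C \<in> C \<and> h (g C) \<noteq> h e \<and> g C \<in> P" if "\<exists>f\<in>C. h f \<noteq> h e \<and> f \<in> P" for C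
    unfolding g_def by (rule someI_ex) (use that in blast)
  have fin: "finite e" using card_edge[OF assms(1)] by (metis card.infinite zero_neq_numeral)
  have "card {C \<in> cyc e. \<exists>f\<in>C. h f \<noteq> h e \<and> f \<in> P} \<le> card ?G"
  proof (rule card_inj_on_le[of g])
    show "inj_on g {C \<in> cyc e. \<exists>f\<in>C. h f \<noteq> h e \<and> f \<in> P}"
      by (rule inj_onI) (use g cyc_determined_edges in \<open>(clarify, metis)\<close>)
    show "g ` {C \<in> cyc e. \<exists>f\<in>C. h f \<noteq> h e \<and> f \<in> P} \<subseteq> ?G"
      using g adjacent_edge cyc_subset by fastforce
    show "finite ?G" using fin fin_E by auto
  qed
  also have "\<dots> \<le> (\<Sum>v\<in>e. card {f \<in> E. v \<in> f \<and> f \<in> P})" using fin by (rule card_UN_le)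
  also have "\<dots> \<le> (\<Sum>v\<in>e. k)" using P by (rule sum_mono)
  also have "\<dots> = 2 * k" using card_edge[OF assms(1)] by simp
  finally show ?thesis .
qed

text \<open>The factor 2 is there because two disjoint edges of one color may lie on two common 4-cycles.\<close>

lemma card_opposite_cycles:
  assumes "e \<in> E" and P: "card {f \<in> E. f \<in> nbhd E 6 e \<and> h f = h e \<and> f \<in> P} \<le> k"
  shows "card {C \<in> cyc e. \<exists>f\<in>C. f \<noteq> e \<and> h f = h e \<and> f \<in> P} \<le> 2 * k"
proof -
  let ?N = "{f \<in> E. f \<in> nbhd E 6 e \<and> h f = h e \<and> f \<in> P}"
  let ?A = "{C \<in> cyc e. \<exists>f\<in>C. f \<noteq> e \<and> h f = h e \<and> f \<in> P}"
  obtain u where u: "u \<in> e" using card_edge[OF assms(1)] by fastforce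
  \<comment> \<open>A cycle is encoded by its opposite edge and the endpoint of that edge joined to
    \<open>u\<close>. The joining edge has the second color and so determines the cycle.\<close>
  define good where "good C p \<longleftrightarrow> fst p \<in> ?N \<and> snd p \<in> fst p \<and> {u, snd p} \<in> C \<and> h {u, snd p} \<noteq> h e"
    for C and p :: "'a set \<times> 'a"
  define g where "g C = (SOME p. good C p)" for C
  have g: "good C (g C)" if "C \<in> ?A" for C
  proof -
    obtain f where C: "C \<in> cyc e" and f: "f \<in> C" "f \<noteq> e" "h f = h e" "f \<in> P" using \<open>C \<in> ?A\<close> by blast
    obtain x where x: "x \<in> f" "{u, x} \<in> C" "h {u, x} \<noteq> h e"
      using opposite_edge[OF C f(1-3) u] by blast
    have "good C (f, x)"
      using x f opposite_edge_in_nbhd[OF C f(1-3)] cyc_subset[OF C] unfolding good_def by auto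
    then show ?thesis unfolding g_def by (rule someI)
  qed
  have fin: "finite f" if "f \<in> ?N" for f
    using card_edge[of f] that by (metis (lifting) card.infinite mem_Collect_eq zero_neq_numeral)
  have "card ?A \<le> card (SIGMA f:?N. f)"
  proof (rule card_inj_on_le[of g])
    show "inj_on g ?A"
    proof (rule inj_onI)
      fix C D assume CD: "C \<in> ?A" "D \<in> ?A" "g C = g D"
      then show "C = D"
        using g[OF CD(1)] g[OF CD(2)] cyc_determined_edges[of C e D "{u, snd (g C)}"]
        unfolding good_def by auto
    qed
    show "g ` ?A \<subseteq> (SIGMA f:?N. f)"
    proof
      fix p assume "p \<in> g ` ?A"
      then obtain C where "C \<in> ?A" "p = g C" by blast
      with g[of C] have "(fst p, snd p) \<in> (SIGMA f:?N. f)" unfolding good_def by blast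
      then show "p \<in> (SIGMA f:?N. f)" by simp
    qed
    show "finite (SIGMA f:?N. f)" using fin fin_E by auto
  qed
  also have "\<dots> = (\<Sum>f\<in>?N. card f)" using fin fin_E by (intro card_SigmaI) auto
  also have "\<dots> = (\<Sum>f\<in>?N. 2)" using card_edge by (intro sum.cong) auto
  also have "\<dots> \<le> 2 * k" using P by simp
  finally show ?thesis .
qed

subsection \<open>Choice of the permutation and of the cycles\<close>

text \<open>The probabilistic step as pure counting: if every permutation were bad, the bad sets for
  all vertices and edges would cover all \<open>fact (card S)\<close> of them, against
  \<open>small\<close>. The second event needs randomness because the opposite edge and the color it
  receives both vary with the cycle, while sparseness bounds one color at a time.\<close>

lemma exists_good_permutation:
  assumes "h ` E \<subseteq> S" "finite S" "finite V"
    and L: "\<And>e. e \<in> E \<Longrightarrow> finite (L e) \<and> card (L e) \<le> m"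
    and small: "(card V + card E) * m ^ k < fact k"
  obtains \<pi> where "inj_on \<pi> S" "\<pi> ` S \<subseteq> S"
    "\<And>v. v \<in> V \<Longrightarrow> card {f \<in> E. v \<in> f \<and> \<pi> (h f) \<in> L f} < k"
    "\<And>e. e \<in> E \<Longrightarrow>
      card {C \<in> cyc e. \<exists>f\<in>C. f \<noteq> e \<and> h f = h e \<and> \<pi> (swapped h C e) \<in> L f} < k"
proof (rule ccontr)
  let ?Inj = "{\<pi> \<in> S \<rightarrow>\<^sub>E S. inj_on \<pi> S}"
  let ?BV = "\<lambda>v. {\<pi> \<in> S \<rightarrow>\<^sub>E S. inj_on \<pi> S \<and> k \<le> card {f \<in> {f \<in> E. v \<in> f}. \<pi> (h f) \<in> L f}}"
  \<comment> \<open>This is the list of the edge opposite to \<open>e\<close>, or empty if there is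
    none; uniqueness of the opposite edge keeps its size at most \<open>m\<close>.\<close>
  define A where "A e C = {c. \<exists>f\<in>C. f \<noteq> e \<and> h f = h e \<and> c \<in> L f}" for e C
  let ?BE = "\<lambda>e. {\<pi> \<in> S \<rightarrow>\<^sub>E S. inj_on \<pi> S \<and> k \<le> card {C \<in> cyc e. \<pi> (swapped h C e) \<in> A e C}}"
  assume "\<not> thesis"
  have cover: "?Inj \<subseteq> (\<Union>v\<in>V. ?BV v) \<union> (\<Union>e\<in>E. ?BE e)"
  proof (rule subsetI, rule ccontr)
    fix \<pi> assume "\<pi> \<in> ?Inj" and "\<pi> \<notin> (\<Union>v\<in>V. ?BV v) \<union> (\<Union>e\<in>E. ?BE e)"
    then have \<pi>: "\<pi> \<in> ?Inj" "\<And>v. v \<in> V \<Longrightarrow> \<pi> \<notin> ?BV v" "\<And>e. e \<in> E \<Longrightarrow> \<pi> \<notin> ?BE e"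
      by (simp_all only: Un_iff UN_iff) blast+
    have "thesis"
    proof (rule that[of \<pi>])
      show "inj_on \<pi> S" "\<pi> ` S \<subseteq> S" using \<pi>(1) by auto
      show "card {f \<in> E. v \<in> f \<and> \<pi> (h f) \<in> L f} < k" if "v \<in> V" for v
        using \<pi>(1) \<pi>(2)[OF that] by (simp add: conj_assoc)
      show "card {C \<in> cyc e. \<exists>f\<in>C. f \<noteq> e \<and> h f = h e \<and> \<pi> (swapped h C e) \<in> L f} < k"
        if "e \<in> E" for e
        using \<pi>(1) \<pi>(3)[OF that] by (simp add: A_def)
    qed
    with \<open>\<not> thesis\<close> show False by blast
  qed
  have fin: "finite X" if "X \<subseteq> S \<rightarrow>\<^sub>E S" for X
    using that assms(2) by (meson finite_PiE finite_subset)
  have V: "card (?BV v) * fact k \<le> m ^ k * fact (card S)" for v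
    using assms(1,2) L fin_E inj_on_at_vertex[of v]
    by (intro card_injections_many_hits) auto
  have E: "card (?BE e) * fact k \<le> m ^ k * fact (card S)" for e
  proof (rule card_injections_many_hits)
    show "(\<lambda>C. swapped h C e) ` cyc e \<subseteq> S"
      using swapped(2) cyc_subset assms(1) by blast
    fix C assume C: "C \<in> cyc e"
    show "finite (A e C) \<and> card (A e C) \<le> m"
    proof (cases "\<exists>f\<in>C. f \<noteq> e \<and> h f = h e")
      case True
      then obtain f where f: "f \<in> C" "f \<noteq> e" "h f = h e" by blast
      then have "A e C = L f" using opposite_edge_unique[OF C f] unfolding A_def by blast
      then show ?thesis using L f cyc_subset[OF C] by auto
    next
      case False
      then have "A e C = {}" unfolding A_def by blast
      then show ?thesis by simp
    qed
  qed (use assms finite_cyc inj_on_swapped in auto)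
  have "card ?Inj \<le> card ((\<Union>v\<in>V. ?BV v) \<union> (\<Union>e\<in>E. ?BE e))"
    by (rule card_mono[OF fin cover]) blast
  also have "\<dots> \<le> card (\<Union>v\<in>V. ?BV v) + card (\<Union>e\<in>E. ?BE e)" by (rule card_Un_le)
  also have "\<dots> \<le> (\<Sum>v\<in>V. card (?BV v)) + (\<Sum>e\<in>E. card (?BE e))"
    using assms(3) fin_E by (intro add_mono card_UN_le)
  finally have "card ?Inj * fact k \<le> ((\<Sum>v\<in>V. card (?BV v)) + (\<Sum>e\<in>E. card (?BE e))) * fact k"
    by (rule mult_le_mono1)
  also have "\<dots> = (\<Sum>v\<in>V. card (?BV v) * fact k) + (\<Sum>e\<in>E. card (?BE e) * fact k)"
    by (simp only: add_mult_distrib sum_distrib_right)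
  also have "\<dots> \<le> (\<Sum>v\<in>V. m ^ k * fact (card S)) + (\<Sum>e\<in>E. m ^ k * fact (card S))"
    using V E by (intro add_mono sum_mono)
  also have "\<dots> = ((card V + card E) * m ^ k) * fact (card S)"
    by (simp add: add_mult_distrib)
  also have "\<dots> < fact k * fact (card S)" using small by (intro mult_strict_right_mono) auto
  also have "\<dots> = card ?Inj * fact k" using card_injections[OF assms(2,2) refl] by simp
  finally show False by simp
qed

text \<open>The numbers fit as follows. At most \<open>2 * k + 2 * m\<close> cycles through an edge
  contain another conflict and at most \<open>k + 3 * m\<close> are harmful, so
  \<open>32 * (k + m)\<close> candidates remain. A candidate has at most four edges and hence meets
  at most \<open>8 * (k + m)\<close> candidates of other conflicts, a quarter of that, as
  \<open>independent_transversal\<close> requires.\<close>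

lemma avoidable_of_good_permutation:
  assumes col: "h ` E \<subseteq> {1..d}" and \<pi>: "inj_on \<pi> {1..d}" "\<pi> ` {1..d} \<subseteq> {1..d}"
    and L: "\<And>e. e \<in> E \<Longrightarrow> finite (L e) \<and> card (L e) \<le> m"
    and vertex: "\<And>e v c. e \<in> E \<Longrightarrow> v \<in> e \<Longrightarrow> c \<in> {1..d} \<Longrightarrow> card {f \<in> E. v \<in> f \<and> c \<in> L f} \<le> m"
    and matching: "\<And>e c. e \<in> E \<Longrightarrow> c \<in> {1..d} \<Longrightarrow>
      card {f \<in> E. f \<in> nbhd E 6 e \<and> h f = h e \<and> c \<in> L f} \<le> m"
    and conflict: "\<And>e v. e \<in> E \<Longrightarrow> v \<in> e \<Longrightarrow> card {f \<in> E. v \<in> f \<and> \<pi> (h f) \<in> L f} \<le> k"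
    and opposite: "\<And>e. e \<in> E \<Longrightarrow>
      card {C \<in> cyc e. \<exists>f\<in>C. f \<noteq> e \<and> h f = h e \<and> \<pi> (swapped h C e) \<in> L f} \<le> k"
    and many: "\<And>e. e \<in> E \<Longrightarrow> 35 * k + 37 * m \<le> card (cyc e)" and pos: "0 < k + m"
  shows "avoidable E d L"
proof -
  define P where "P = {f \<in> E. \<pi> (h f) \<in> L f}"
  define near where "near e = {C \<in> cyc e. \<exists>f\<in>C. f \<noteq> e \<and> f \<in> P}" for e
  define harm where "harm e = {C \<in> cyc e. \<exists>f\<in>C. \<pi> (swapped h C f) \<in> L f}" for e
  define part where "part e = cyc e - near e - harm e" for e
  have \<pi>E: "\<pi> (h e) \<in> {1..d}" if "e \<in> E" for e using that col \<pi>(2) by blast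
  have PE: "P \<subseteq> E" "finite P" using fin_E unfolding P_def by auto
  have near: "card (near e) \<le> 2 * k + 2 * m" if e: "e \<in> E" for e
  proof -
    let ?X = "{C \<in> cyc e. \<exists>f\<in>C. h f \<noteq> h e \<and> f \<in> P}"
    let ?Y = "{C \<in> cyc e. \<exists>f\<in>C. f \<noteq> e \<and> h f = h e \<and> f \<in> P}"
    have "near e = ?X \<union> ?Y" unfolding near_def by auto
    then have "card (near e) \<le> card ?X + card ?Y" using card_Un_le[of ?X ?Y] by simp
    also have "card ?X \<le> 2 * k"
      using conflict[OF e] unfolding P_def by (intro card_adjacent_cycles[OF e]) (simp cong: conj_cong)
    also have "card ?Y \<le> 2 * m"
    proof (rule card_opposite_cycles[OF e])
      have "{f \<in> E. f \<in> nbhd E 6 e \<and> h f = h e \<and> f \<in> P}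
        = {f \<in> E. f \<in> nbhd E 6 e \<and> h f = h e \<and> \<pi> (h e) \<in> L f}"
        unfolding P_def by auto
      then show "card {f \<in> E. f \<in> nbhd E 6 e \<and> h f = h e \<and> f \<in> P} \<le> m"
        using matching[OF e \<pi>E[OF e]] by simp
    qed
    finally show ?thesis by simp
  qed
  have harm: "card (harm e) \<le> k + 3 * m" if e: "e \<in> E" for e
  proof -
    let ?X = "{C \<in> cyc e. \<pi> (swapped h C e) \<in> L e}"
    let ?Y = "{C \<in> cyc e. \<exists>f\<in>C. h f \<noteq> h e \<and> f \<in> {f. \<pi> (h e) \<in> L f}}"
    let ?Z = "{C \<in> cyc e. \<exists>f\<in>C. f \<noteq> e \<and> h f = h e \<and> \<pi> (swapped h C e) \<in> L f}"
    have fin: "finite ?X" "finite ?Y" "finite ?Z" using finite_cyc by auto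
    \<comment> \<open>The edge harmed by the swap is \<open>e\<close> itself, an adjacent edge,
      which receives the fixed color \<open>\<pi> (h e)\<close>, or the opposite edge, which
      receives the same new color as \<open>e\<close>. The bounds are \<open>m\<close>,
      \<open>2 * m\<close> and \<open>k\<close>.\<close>
    have "harm e \<subseteq> ?X \<union> (?Y \<union> ?Z)"
    proof
      fix C assume "C \<in> harm e"
      then obtain f where C: "C \<in> cyc e" and f: "f \<in> C" "\<pi> (swapped h C f) \<in> L f"
        unfolding harm_def by blast
      consider "f = e" | "h f \<noteq> h e" | "f \<noteq> e" "h f = h e" by blast
      then show "C \<in> ?X \<union> (?Y \<union> ?Z)"
      proof cases
        case 1 then show ?thesis using C f by blast
      next
        case 2
        then have "swapped h C f = h e"
          using swapped_eqI[OF cyc_cong[OF C f(1)] cyc_mem[OF C]] by simp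
        then show ?thesis using 2 C f by auto
      next
        case 3 then show ?thesis using C f swapped_same[OF C f(1)] by auto
      qed
    qed
    then have "card (harm e) \<le> card (?X \<union> (?Y \<union> ?Z))" using fin by (intro card_mono) auto
    also have "\<dots> \<le> card ?X + (card ?Y + card ?Z)"
      using card_Un_le[of ?X "?Y \<union> ?Z"] card_Un_le[of ?Y ?Z] by linarith
    also have "card ?X \<le> card (L e)"
    proof (rule card_inj_on_le)
      show "inj_on (\<lambda>C. \<pi> (swapped h C e)) ?X"
      proof (rule inj_onI)
        fix C D assume CD: "C \<in> ?X" "D \<in> ?X" "\<pi> (swapped h C e) = \<pi> (swapped h D e)"
        have "swapped h C e \<in> {1..d}" "swapped h D e \<in> {1..d}"
          using CD swapped(2)[of C e] swapped(2)[of D e] cyc_subset[of C e] cyc_subset[of D e] col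
          by blast+
        then have "swapped h C e = swapped h D e" using CD \<pi>(1) by (meson inj_onD)
        then show "C = D" using CD inj_on_swapped[of e] by (simp add: inj_on_def)
      qed
    qed (use L e in auto)
    also have "card (L e) \<le> m" using L e by blast
    also have "card ?Y \<le> 2 * m"
      using vertex[OF e] \<pi>E[OF e] by (intro card_adjacent_cycles[OF e]) auto
    also have "card ?Z \<le> k" using opposite[OF e] .
    finally show ?thesis by simp
  qed
  have part: "finite (part e) \<and> 32 * (k + m) \<le> card (part e)" if e: "e \<in> E" for e
  proof -
    have "near e \<subseteq> cyc e" "harm e \<subseteq> cyc e" unfolding near_def harm_def by auto
    then have fin: "finite (near e)" "finite (harm e)" using finite_cyc finite_subset by blast+
    have "card (cyc e) \<le> card (part e) + card (near e) + card (harm e)"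
      using diff_card_le_card_Diff[OF fin(1), of "cyc e"]
        diff_card_le_card_Diff[OF fin(2), of "cyc e - near e"]
      unfolding part_def by linarith
    then show ?thesis using near[OF e] harm[OF e] many[OF e] finite_cyc unfolding part_def by auto
  qed
  have part_P: "x \<in> cyc e" "x \<inter> P \<subseteq> {e}" "e \<in> x" if "x \<in> part e" for x e
    using that cyc_mem unfolding part_def near_def by auto
  obtain t where t: "\<And>e. e \<in> P \<Longrightarrow> t e \<in> part e"
    and disj: "\<And>e f. e \<in> P \<Longrightarrow> f \<in> P \<Longrightarrow> e \<noteq> f \<Longrightarrow> \<not> \<not> disjnt (t e) (t f)"
  proof (rule independent_transversal[of P "\<lambda>x y. \<not> disjnt x y" part "32 * (k + m)" "8 * (k + m)"])
    fix e x assume e: "e \<in> P" and x: "x \<in> part e"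
    let ?N = "{(f, y). f \<in> P \<and> f \<noteq> e \<and> y \<in> part f \<and> \<not> disjnt x y}"
    have xE: "x \<subseteq> E" using cyc_subset part_P[OF x] by blast
    \<comment> \<open>A pair is determined by its cycle \<open>y\<close>, whose only conflict is
      \<open>f\<close>. If \<open>x\<close> and \<open>y\<close> share \<open>g\<close>, then
      \<open>g\<close> is not \<open>f\<close>, since \<open>x\<close> contains no conflict besides
      \<open>e\<close>; so \<open>y\<close> is a cycle through \<open>g\<close> with another
      conflict on it.\<close>
    have "card ?N \<le> card (\<Union>f\<in>x. near f)"
    proof (rule card_inj_on_le[of snd])
      show "inj_on snd ?N"
        by (rule inj_onI) (use part_P in fastforce)
      show "snd ` ?N \<subseteq> (\<Union>f\<in>x. near f)"
      proof clarsimp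
        fix f y assume f: "f \<in> P" "f \<noteq> e" and y: "y \<in> part f" and "\<not> disjnt x y"
        then obtain g where g: "g \<in> x" "g \<in> y" by (auto simp: disjnt_iff)
        have "g \<noteq> f" using g f part_P(2)[OF x] by blast
        then have "y \<in> near g" using g f part_P[OF y] cyc_cong unfolding near_def by blast
        then show "\<exists>g\<in>x. y \<in> near g" using g by blast
      qed
      show "finite (\<Union>f\<in>x. near f)"
        using card_cycle(1)[OF part_P(1)[OF x]] finite_cyc unfolding near_def by auto
    qed
    also have "\<dots> \<le> (\<Sum>f\<in>x. card (near f))"
      using card_cycle(1)[OF part_P(1)[OF x]] by (rule card_UN_le)
    also have "\<dots> \<le> (\<Sum>f\<in>x. 2 * k + 2 * m)" using near xE by (intro sum_mono) blast
    also have "\<dots> = card x * (2 * k + 2 * m)" by simp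
    also have "\<dots> \<le> 4 * (2 * k + 2 * m)"
      using card_cycle(2)[OF part_P(1)[OF x]] by (rule mult_le_mono1)
    finally show "card ?N \<le> 8 * (k + m)" by simp
  qed (use part pos PE in \<open>auto simp: disjnt_sym\<close>)
  define \<phi> where "\<phi> f = \<pi> (swap_all (t ` P) f)" for f
  have pd: "pairwise disjnt (t ` P)"
    unfolding pairwise_def using disj by fastforce
  have tc: "C \<in> cyc f" if "C \<in> t ` P" "f \<in> C" for C f
    using that t part_P cyc_cong by blast
  have swap_col: "swap_all (t ` P) f \<in> {1..d}" if f: "f \<in> E" for f
  proof (cases "f \<in> \<Union>(t ` P)")
    case True
    then obtain C where C: "C \<in> t ` P" "f \<in> C" by blast
    have "swapped h C f \<in> h ` C" using swapped(2)[OF tc[OF C]] by blast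
    then have "swapped h C f \<in> {1..d}" using cyc_subset[OF tc[OF C]] col by blast
    then show ?thesis using swap_all_in[OF pd C] by simp
  qed (use f col swap_all_def in auto)
  have "proper_edge_coloring E d \<phi>"
    unfolding proper_edge_coloring_def properly_colored_def
  proof (intro conjI ballI impI)
    show "\<phi> ` E \<subseteq> {1..d}" using swap_col \<pi>(2) unfolding \<phi>_def by blast
    fix e f assume ef: "e \<in> E" "f \<in> E" "e \<noteq> f \<and> e \<inter> f \<noteq> {}"
    then have "swap_all (t ` P) e \<noteq> swap_all (t ` P) f"
      using properly_colored_swap_all[OF pd tc] unfolding properly_colored_def by blast
    then show "\<phi> e \<noteq> \<phi> f"
      unfolding \<phi>_def using swap_col ef \<pi>(1) by (meson inj_onD)
  qed
  moreover have "\<phi> e \<notin> L e" if e: "e \<in> E" for e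
  proof (cases "e \<in> \<Union>(t ` P)")
    case True
    then obtain f where f: "f \<in> P" "e \<in> t f" by blast
    then have "swap_all (t ` P) e = swapped h (t f) e" using swap_all_in[OF pd] by blast
    moreover have "t f \<in> cyc f - harm f" using t[OF f(1)] unfolding part_def by blast
    ultimately show ?thesis unfolding \<phi>_def harm_def using f by auto
  next
    case False
    \<comment> \<open>Every conflict lies on its own chosen cycle, so an edge off all chosen cycles
      keeps an allowed color.\<close>
    then have "e \<notin> P" using t part_P(3) by blast
    then show ?thesis using False e unfolding \<phi>_def swap_all_def P_def by simp
  qed
  ultimately show ?thesis unfolding avoidable_def by blast
qed

end

section \<open>Numerical parameters and the final theorem\<close>

lemma card_edges_le:
  assumes "simple_graph V E"
  shows "finite E" "card E \<le> (card V)\<^sup>2"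
proof -
  have V: "finite V" using assms unfolding simple_graph_def by blast
  have "E \<subseteq> (\<lambda>(a, b). {a, b}) ` (V \<times> V)"
  proof
    fix e assume "e \<in> E"
    then obtain a b where "e = {a, b}" "a \<in> V" "b \<in> V"
      using assms unfolding simple_graph_def by (metis card_2_iff insert_subset)
    then show "e \<in> (\<lambda>(a, b). {a, b}) ` (V \<times> V)" by auto
  qed
  with V show "finite E" "card E \<le> (card V)\<^sup>2"
    using card_mono[of "(\<lambda>(a, b). {a, b}) ` (V \<times> V)" E] card_image_le[of "V \<times> V" "\<lambda>(a, b). {a, b}"]
    by (auto simp: card_cartesian_product power2_eq_square finite_subset)
qed

text \<open>It remains to round: \<open>k\<close> is about \<open>s / 200\<close>, \<open>m\<close>
  is the integer part of \<open>\<beta> * s\<close>, and the assumed bound on \<open>\<beta>\<close>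
  must give both enough cycles per edge and the strict inequality of the union bound.\<close>

lemma avoidable_of_sparse:
  fixes \<kappa> \<beta> :: real
  assumes \<kappa>: "0 < \<kappa>"
    and G: "simple_graph V E" and n: "card V = n" and sd: "real s / real d = \<kappa>"
    and h: "standard_coloring E d s h"
    and \<beta>: "\<beta> \<le> 1 / 1200 * (2 * real n) powr (- (400 / \<kappa>) / real d)"
    and L: "list_assignment E d L" and sparse: "sparse V E d s h \<beta> L"
  shows "avoidable E d L"
proof (cases "\<exists>e\<in>E. L e \<noteq> {}")
  \<comment> \<open>If all lists are empty, \<open>h\<close> itself works. Otherwise a nonempty list
    forces \<open>\<beta> * s \<ge> 1\<close>, hence \<open>m \<ge> 1\<close>, which is used
    repeatedly below.\<close>
  case False
  then show ?thesis using h unfolding avoidable_def standard_coloring_def by auto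
next
  case True
  then obtain e0 where e0: "e0 \<in> E" "L e0 \<noteq> {}" by blast
  define x where "x = 2 * real n"
  define k where "k = nat \<lceil>real s / 200\<rceil>"
  define m where "m = nat \<lfloor>\<beta> * real s\<rfloor>"
  define y where "y = x powr (- (400 / \<kappa>) / real d)"
  interpret edge_colored_graph E h
    using G h card_edges_le[OF G] unfolding simple_graph_def standard_coloring_def
      proper_edge_coloring_def by unfold_locales auto
  have d: "0 < real d" using sd \<kappa> by (cases "d = 0") auto
  have s: "real s = \<kappa> * real d" using sd d by (simp add: field_simps)
  have "0 < real s" using s \<kappa> d by simp
  have finV: "finite V" using G unfolding simple_graph_def by blast
  have EV: "e \<subseteq> V" if "e \<in> E" for e using G that unfolding simple_graph_def by blast
  have finL: "finite (L e)" if "e \<in> E" for e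
    using L that unfolding list_assignment_def by (meson finite_atLeastAtMost finite_subset)
  have "1 \<le> card (L e0)" using e0 finL by (simp add: Suc_leI card_gt_0_iff)
  then have "1 \<le> real (card (L e0))" by simp
  also have "\<dots> \<le> \<beta> * real s" using sparse e0 unfolding sparse_def by blast
  finally have \<beta>s: "1 \<le> \<beta> * real s" .
  have to_m: "a \<le> m" if "real a \<le> \<beta> * real s" for a
    using that unfolding m_def by (simp add: le_nat_floor)
  have m: "real m \<le> \<beta> * real s" "1 \<le> m" using \<beta>s unfolding m_def by linarith+
  have "e0 \<noteq> {}" using card_edge[OF e0(1)] by auto
  then have "0 < n" using EV[OF e0(1)] finV n by (auto simp: card_gt_0_iff)
  then have x: "2 \<le> x" unfolding x_def by simp
  have y: "0 < y" "y \<le> 1"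
    using x \<kappa> d powr_mono[of "- (400 / \<kappa>) / real d" 0 x] unfolding y_def by auto
  have \<beta>y: "\<beta> \<le> y / 1200" using \<beta> unfolding y_def x_def by simp
  have ms: "real m \<le> real s / 1200 * y"
    using m(1) mult_right_mono[OF \<beta>y, of "real s"] by (simp add: mult.commute)
  have k: "real s / 200 \<le> real k" "real k \<le> real s / 200 + 1" "0 < k"
    using \<open>0 < real s\<close> unfolding k_def by linarith+
  have ms': "real m \<le> real s / 1200"
    using ms mult_left_mono[OF y(2), of "real s / 1200"] by simp
  \<comment> \<open>Since \<open>1 \<le> m \<le> s / 1200\<close>, \<open>s\<close> is at least
    1200, which absorbs the rounding in \<open>k\<close>. The summand 1 pays for the
    \<open>s - 1\<close> cycles guaranteed by the standard coloring.\<close>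
  then have "real (35 * k + 37 * m + 1) \<le> real s" using k(2) m(2) by simp
  then have km: "35 * k + 37 * m + 1 \<le> s" by linarith
  have "real s / 200 * y \<le> real k * y" using k(1) y(1) by (intro mult_right_mono) auto
  \<comment> \<open>From 1200 = 6 * 200. The factor 6 beats the 3 of
    \<open>power_self_le_fact\<close>; the surplus \<open>2 ^ k\<close> is discarded.\<close>
  then have "real m \<le> real k / 6 * y" using ms by linarith
  then have "real m ^ k \<le> (real k / 6 * y) ^ k" by (rule power_mono) simp
  also have "\<dots> = real k ^ k * y ^ k / 6 ^ k" by (simp add: power_mult_distrib power_divide)
  also have "\<dots> \<le> (3 ^ k * fact k) * y ^ k / 6 ^ k"
    using power_self_le_fact[of k] y(1) by (intro divide_right_mono mult_right_mono) auto
  also have "\<dots> = fact k * (y ^ k / 2 ^ k)"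
    using power_mult_distrib[of 3 "2 :: real" k] by simp
  also have "\<dots> \<le> fact k * (y ^ k / 1)"
    using y(1) by (intro mult_left_mono divide_left_mono) auto
  also have "y ^ k = x powr (- (400 / \<kappa>) / real d * real k)"
    using x unfolding y_def by (simp add: powr_powr flip: powr_realpow)
  also have "\<dots> \<le> x powr (- 2)"
  proof (rule powr_mono)
    \<comment> \<open>The constant 400 is chosen so that \<open>k \<ge> s / 200\<close> factors of
      \<open>y\<close> yield at most \<open>x powr (- 2)\<close>, enough against fewer than
      \<open>x\<close> squared bad events.\<close>
    have "2 = 400 / \<kappa> / real d * (real s / 200)" using s \<kappa> d by simp
    also have "\<dots> \<le> 400 / \<kappa> / real d * real k" using k(1) \<kappa> d by (intro mult_left_mono) auto
    finally show "- (400 / \<kappa>) / real d * real k \<le> - 2" by simp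
  qed (use x in auto)
  also have "x powr (- 2) = 1 / x\<^sup>2" using x by (simp add: powr_minus_divide)
  finally have mk: "real m ^ k \<le> fact k / x\<^sup>2" by simp
  have "real (card V + card E) \<le> real n + (real n)\<^sup>2"
    using card_edges_le(2)[OF G] n by (metis add_left_mono of_nat_add of_nat_mono of_nat_power)
  also have "\<dots> < x\<^sup>2" using \<open>0 < n\<close> unfolding x_def power2_eq_square by (simp add: add_strict_increasing)
  finally have "real (card V + card E) * real m ^ k < x\<^sup>2 * (fact k / x\<^sup>2)"
    using mk x m(2) by (intro mult_less_le_imp_less) auto
  then have "real ((card V + card E) * m ^ k) < real (fact k)" using x by simp
  then have small: "(card V + card E) * m ^ k < fact k" by (simp only: of_nat_less_iff)
  have col: "h ` E \<subseteq> {1..d}" using h unfolding standard_coloring_def proper_edge_coloring_def by blast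
  have Lm: "finite (L e) \<and> card (L e) \<le> m" if "e \<in> E" for e
    using finL that to_m sparse unfolding sparse_def by blast
  obtain \<pi> where \<pi>: "inj_on \<pi> {1..d}" "\<pi> ` {1..d} \<subseteq> {1..d}"
    "\<And>v. v \<in> V \<Longrightarrow> card {f \<in> E. v \<in> f \<and> \<pi> (h f) \<in> L f} < k"
    "\<And>e. e \<in> E \<Longrightarrow>
      card {C \<in> cyc e. \<exists>f\<in>C. f \<noteq> e \<and> h f = h e \<and> \<pi> (swapped h C e) \<in> L f} < k"
    using exists_good_permutation[OF col finite_atLeastAtMost finV, of L m k] Lm small by blast
  show ?thesis
  proof (rule avoidable_of_good_permutation[OF col \<pi>(1,2), of L m k])
    show "finite (L e) \<and> card (L e) \<le> m" if "e \<in> E" for e using that by (rule Lm)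
  next
    fix e v c assume "e \<in> E" "v \<in> e" "c \<in> {1..d}"
    then show "card {f \<in> E. v \<in> f \<and> c \<in> L f} \<le> m"
      using EV to_m sparse unfolding sparse_def by blast
  next
    fix e c assume e: "e \<in> E" and c: "c \<in> {1..d}"
    have "{f \<in> E. h f = h e} \<in> standard_matchings E d h"
      using e col unfolding standard_matchings_def by blast
    then have "card {f \<in> {f \<in> E. h f = h e} \<inter> nbhd E 6 e. c \<in> L f} \<le> m"
      using e c to_m sparse unfolding sparse_def by blast
    moreover have "{f \<in> {f \<in> E. h f = h e} \<inter> nbhd E 6 e. c \<in> L f}
      = {f \<in> E. f \<in> nbhd E 6 e \<and> h f = h e \<and> c \<in> L f}" by blast
    ultimately show "card {f \<in> E. f \<in> nbhd E 6 e \<and> h f = h e \<and> c \<in> L f} \<le> m" by simp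
  next
    fix e v assume "e \<in> E" "v \<in> e"
    then show "card {f \<in> E. v \<in> f \<and> \<pi> (h f) \<in> L f} \<le> k" using \<pi>(3) EV by (meson less_imp_le subsetD)
  next
    fix e assume e: "e \<in> E"
    then show "card {C \<in> cyc e. \<exists>f\<in>C. f \<noteq> e \<and> h f = h e \<and> \<pi> (swapped h C e) \<in> L f} \<le> k"
      using \<pi>(4) by (meson less_imp_le)
    have "s - 1 \<le> card (cyc e)"
      using h e unfolding standard_coloring_def cycles_through_def by blast
    then show "35 * k + 37 * m \<le> card (cyc e)" using km by linarith
  qed (use k(3) in simp_all)
qed

theorem corollary1p2:
  fixes \<kappa> :: real
  assumes "0 < \<kappa>" and "\<kappa> \<le> 1"
  shows "\<exists>c1 c2 :: real. c1 > 0 \<and> c2 > 0 \<and>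
    (\<forall>(V :: 'a set) (E :: 'a set set) (n :: nat) (d :: nat) (s :: nat)
       (h :: 'a set \<Rightarrow> nat) (\<beta> :: real) (L :: 'a set \<Rightarrow> nat set).
       simple_graph V E \<longrightarrow> card V = n \<longrightarrow>
       ds_edge_colorable V E d s \<longrightarrow> s \<ge> 11 \<longrightarrow> real s / real d = \<kappa> \<longrightarrow>
       standard_coloring E d s h \<longrightarrow>
       \<beta> \<le> c1 * (2 * real n) powr (- c2 / real d) \<longrightarrow>
       list_assignment E d L \<longrightarrow> sparse V E d s h \<beta> L \<longrightarrow>
       avoidable E d L)"
proof (intro exI conjI allI impI)
  \<comment> \<open>The witnesses are \<open>c1 = 1 / 1200\<close> and
    \<open>c2 = 400 / \<kappa>\<close>; only the second depends on \<open>\<kappa>\<close>, which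
    converts an exponent in \<open>1 / d\<close> into one in \<open>1 / s\<close>.\<close>
  show "(0 :: real) < 1 / 1200" by simp
  show "0 < 400 / \<kappa>" using assms by simp
  fix V :: "'a set" and E n d s h \<beta> L
  assume "simple_graph V E" "card V = n" "real s / real d = \<kappa>" "standard_coloring E d s h"
    "\<beta> \<le> 1 / 1200 * (2 * real n) powr (- (400 / \<kappa>) / real d)"
    "list_assignment E d L" "sparse V E d s h \<beta> L"
  then show "avoidable E d L" by (rule avoidable_of_sparse[OF assms(1)])
qed

end
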